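(* Let $H$ be a complex Hilbert space and let $T\in\mathcal{B}(H)$ with $N(T)=N(T^* )$. If $T\in\mathcal{AM}(H)$ and $T$ is paranormal, then $T$ is hyponormal.
   Context: $\mathcal{B}(H)$ is the space of bounded linear operators on $H$ and $N(T)$ is the null space of $T$. A bounded operator $S:H_1\to H_2$ between Hilbert spaces is minimum attaining if there is a unit vector $x\in H_1$ with $\|Sx\|=m(S)$, where $m(S)=\inf\{\|Sx\|:x\in H_1,\ \|x\|=1\}$. $T\in\mathcal{B}(H)$ is absolutely minimum attaining, written $T\in\mathcal{AM}(H)$, if for every nonzero closed subspace $M\subseteq H$ the restriction $T|_M:M\to H$ is minimum attaining. $T$ is paranormal if $\|Tx\|^2\le\|T^2x\|\,\|x\|$ for all $x\in H$. $T$ is hyponormal if $TT^*\le T^*T$, equivalently $\|T^*x\|\le\|Tx\|$ for all $x\in H$. *)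

theory Defs
  imports "HOL-Analysis.Analysis" "HOL-Library.Nonpos_Ints"
begin

text \<open>
  The library has no complex inner product spaces.  The class below adds a complex structure to
  \<^class>\<open>real_inner\<close>.  The inner product is linear in its first argument, and the real inner
  product of the superclass is its real part, so that the norm and the topology of the
  superclass are the ones induced by \<open>cinner\<close> and positive definiteness is inherited.
\<close>

class complex_inner = real_inner +
  fixes scaleC :: "complex \<Rightarrow> 'a \<Rightarrow> 'a" (infixr "*\<^sub>C" 75)
    and cinner :: "'a \<Rightarrow> 'a \<Rightarrow> complex"
  assumes scaleC_add_right: "a *\<^sub>C (x + y) = a *\<^sub>C x + a *\<^sub>C y"
    and scaleC_add_left: "(a + b) *\<^sub>C x = a *\<^sub>C x + b *\<^sub>C x"
    and scaleC_scaleC: "a *\<^sub>C (b *\<^sub>C x) = (a * b) *\<^sub>C x"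
    and scaleC_of_real: "complex_of_real r *\<^sub>C x = r *\<^sub>R x"
    and cinner_add_left: "cinner (x + y) z = cinner x z + cinner y z"
    and cinner_scaleC_left: "cinner (a *\<^sub>C x) y = a * cinner x y"
    and cinner_commute: "cinner x y = cnj (cinner y x)"
    and inner_eq_Re_cinner: "inner x y = Re (cinner x y)"

class chilbert_space = complex_inner + complete_space

subclass (in chilbert_space) banach ..

global_interpretation complex_vector: vector_space "scaleC :: complex \<Rightarrow> 'a \<Rightarrow> 'a::complex_inner"
proof
  show "1 *\<^sub>C x = x" for x :: 'a
    using scaleC_of_real[of 1 x] by simp
qed (simp_all add: scaleC_add_right scaleC_add_left scaleC_scaleC)

instantiation complex :: chilbert_space
begin

definition scaleC_complex :: "complex \<Rightarrow> complex \<Rightarrow> complex"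
  where "scaleC_complex a z = a * z"

definition cinner_complex :: "complex \<Rightarrow> complex \<Rightarrow> complex"
  where "cinner_complex z w = z * cnj w"

instance
  by standard
    (simp_all add: scaleC_complex_def cinner_complex_def algebra_simps scaleR_conv_of_real
      inner_complex_def)

end

lemma cinner_eq_inner:
  "cinner x y = Complex (inner x y) (- inner (\<i> *\<^sub>C x) y)" for x y :: "'a::complex_inner"
  by (simp add: inner_eq_Re_cinner cinner_scaleC_left complex_eq_iff)

definition bounded_clinear :: "('a::complex_inner \<Rightarrow> 'b::complex_inner) \<Rightarrow> bool"
  where "bounded_clinear T \<longleftrightarrow> bounded_linear T \<and> (\<forall>a x. T (a *\<^sub>C x) = a *\<^sub>C T x)"

definition null_space :: "('a::zero \<Rightarrow> 'b::zero) \<Rightarrow> 'a set"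
  where "null_space T = {x. T x = 0}"

definition cadjoint :: "('a::complex_inner \<Rightarrow> 'b::complex_inner) \<Rightarrow> 'b \<Rightarrow> 'a"
  where "cadjoint T = (THE S. \<forall>x y. cinner (T x) y = cinner x (S y))"

text \<open>
  The infimum and the minimum attaining property of the restriction of \<open>T\<close> to a subspace \<open>M\<close>.
  The infimum is that of a nonempty set, bounded below by \<open>0\<close>, as soon as \<open>M\<close> is nonzero.
\<close>

definition min_modulus_on :: "'a::complex_inner set \<Rightarrow> ('a \<Rightarrow> 'b::complex_inner) \<Rightarrow> real"
  where "min_modulus_on M T = Inf {norm (T x) | x. x \<in> M \<and> norm x = 1}"

definition min_attaining_on :: "'a::complex_inner set \<Rightarrow> ('a \<Rightarrow> 'b::complex_inner) \<Rightarrow> bool"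
  where "min_attaining_on M T \<longleftrightarrow> (\<exists>x\<in>M. norm x = 1 \<and> norm (T x) = min_modulus_on M T)"

definition absolutely_min_attaining :: "('a::complex_inner \<Rightarrow> 'a) \<Rightarrow> bool"
  where "absolutely_min_attaining T \<longleftrightarrow> bounded_clinear T \<and>
    (\<forall>M. complex_vector.subspace M \<and> closed M \<and> M \<noteq> {0} \<longrightarrow> min_attaining_on M T)"

definition paranormal :: "('a::complex_inner \<Rightarrow> 'a) \<Rightarrow> bool"
  where "paranormal T \<longleftrightarrow> (\<forall>x. (norm (T x))\<^sup>2 \<le> norm (T (T x)) * norm x)"

definition positive_op :: "('a::complex_inner \<Rightarrow> 'a) \<Rightarrow> bool"
  where "positive_op A \<longleftrightarrow> (\<forall>x. cinner (A x) x \<in> \<real>\<^sub>\<ge>\<^sub>0)"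

definition op_le :: "('a::complex_inner \<Rightarrow> 'a) \<Rightarrow> ('a \<Rightarrow> 'a) \<Rightarrow> bool"
  where "op_le A B \<longleftrightarrow> positive_op (\<lambda>x. B x - A x)"

definition hyponormal :: "('a::complex_inner \<Rightarrow> 'a) \<Rightarrow> bool"
  where "hyponormal T \<longleftrightarrow> op_le (T \<circ> cadjoint T) (cadjoint T \<circ> T)"

text \<open>
  The definite description in \<open>cadjoint\<close> denotes for every bounded operator on a Hilbert space:
  existence comes from the Riesz representation theorem, proved here for the real inner product
  by minimising the norm on the hyperplane \<open>f x = 1\<close>.
\<close>

lemma riesz_real:
  fixes f :: "'a::{real_inner, complete_space} \<Rightarrow> real"
  assumes f: "bounded_linear f"
  shows "\<exists>u. \<forall>x. f x = inner x u"
proof (cases "\<forall>x. f x = 0")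
  case True
  then show ?thesis by (intro exI[of _ 0]) simp
next
  case False
  interpret f: bounded_linear f by (rule f)
  define C where "C = {x. f x = 1}"
  from False obtain x0 where x0: "f x0 \<noteq> 0" by blast
  have "(1 / f x0) *\<^sub>R x0 \<in> C"
    using x0 by (simp add: C_def f.scaleR)
  then have ne: "norm ` C \<noteq> {}" by blast
  define d where "d = Inf (norm ` C)"
  have bdd: "bdd_below (norm ` C)" by (rule bdd_belowI[of _ 0]) auto
  have d_le: "d \<le> norm x" if "x \<in> C" for x
    unfolding d_def using bdd that by (simp add: cINF_lower)
  have d0: "d \<ge> 0" unfolding d_def using ne by (intro cINF_greatest) auto
  have "\<exists>x\<in>C. norm x < d + 1 / real (Suc n)" for n
    using cInf_lessD[OF ne, of "d + 1 / real (Suc n)"] unfolding d_def by auto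
  then obtain X where X: "\<And>n. X n \<in> C" "\<And>n. norm (X n) < d + 1 / real (Suc n)"
    by metis
  have lim: "(\<lambda>n. norm (X n)) \<longlonglongrightarrow> d"
  proof (rule tendsto_sandwich)
    show "(\<lambda>n. d) \<longlonglongrightarrow> d" by simp
    show "(\<lambda>n. d + 1 / real (Suc n)) \<longlonglongrightarrow> d"
      using LIMSEQ_inverse_real_of_nat_add[of d] by (simp add: inverse_eq_divide)
  qed (use X d_le in \<open>auto intro!: always_eventually less_imp_le\<close>)
  have par: "(dist (X m) (X n))\<^sup>2 \<le> 2 * (norm (X m))\<^sup>2 + 2 * (norm (X n))\<^sup>2 - 4 * d\<^sup>2" for m n
  proof -
    have "(1/2) *\<^sub>R (X m + X n) \<in> C"
      using X(1)[of m] X(1)[of n] by (simp add: C_def f.scaleR f.add)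
    from d_le[OF this] have "2 * d \<le> norm (X m + X n)" by simp
    then have "(2 * d)\<^sup>2 \<le> (norm (X m + X n))\<^sup>2" using d0 by (intro power_mono) auto
    then show ?thesis
      by (simp add: dist_norm power2_norm_eq_inner inner_simps power_mult_distrib inner_commute)
  qed
  have "Cauchy X"
  proof (rule metric_CauchyI)
    fix e :: real assume e: "e > 0"
    have "(\<lambda>n. (norm (X n))\<^sup>2) \<longlonglongrightarrow> d\<^sup>2" using lim by (rule tendsto_power)
    then have "\<forall>\<^sub>F n in sequentially. (norm (X n))\<^sup>2 < d\<^sup>2 + e\<^sup>2 / 4"
      using e by (intro order_tendstoD) auto
    then obtain N where N: "\<And>n. n \<ge> N \<Longrightarrow> (norm (X n))\<^sup>2 < d\<^sup>2 + e\<^sup>2 / 4"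
      by (auto simp: eventually_sequentially)
    have "dist (X m) (X n) < e" if "m \<ge> N" "n \<ge> N" for m n
    proof -
      have "(dist (X m) (X n))\<^sup>2 < e\<^sup>2" using par[of m n] N[OF that(1)] N[OF that(2)] by linarith
      then show ?thesis using e by (simp add: power2_less_imp_less)
    qed
    then show "\<exists>M. \<forall>m\<ge>M. \<forall>n\<ge>M. dist (X m) (X n) < e" by blast
  qed
  then obtain u where u: "X \<longlonglongrightarrow> u" by (auto simp: Cauchy_convergent_iff convergent_def)
  have "(\<lambda>n. f (X n)) \<longlonglongrightarrow> f u" using u by (rule f.tendsto)
  then have fu: "f u = 1" using X(1) by (simp add: C_def LIMSEQ_const_iff)
  have nu: "norm u = d"
    using tendsto_norm[OF u] lim by (rule LIMSEQ_unique)
  have orth: "inner k u = 0" if k: "f k = 0" for k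
  proof (rule ccontr)
    assume h: "inner k u \<noteq> 0"
    then have "k \<noteq> 0" by auto
    then have kk: "inner k k > 0" by simp
    define t where "t = - (inner k u / inner k k)"
    have "u + t *\<^sub>R k \<in> C" using fu k by (simp add: C_def f.add f.scaleR)
    then have "norm u \<le> norm (u + t *\<^sub>R k)" using d_le nu by simp
    then have "(norm u)\<^sup>2 \<le> (norm (u + t *\<^sub>R k))\<^sup>2" by (intro power_mono) auto
    then have "0 \<le> 2 * t * inner k u + t * t * inner k k"
      by (simp add: power2_norm_eq_inner inner_simps inner_commute algebra_simps)
    also have "\<dots> = - ((inner k u)\<^sup>2 / inner k k)"
      using kk by (simp add: t_def field_simps power2_eq_square)
    finally have "(inner k u)\<^sup>2 / inner k k \<le> 0" by simp
    moreover have "(inner k u)\<^sup>2 / inner k k > 0" using h kk by simp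
    ultimately show False by simp
  qed
  have "u \<noteq> 0" using fu f.zero by auto
  then have uu: "inner u u \<noteq> 0" by simp
  have "f x = inner x ((1 / inner u u) *\<^sub>R u)" for x
  proof -
    have "f (x - f x *\<^sub>R u) = 0" using fu by (simp add: f.diff f.scaleR)
    from orth[OF this] have "inner x u = f x * inner u u" by (simp add: inner_simps)
    then show ?thesis using uu by simp
  qed
  then show ?thesis by blast
qed

lemma cinner_cadjoint_right:
  fixes T :: "'a::chilbert_space \<Rightarrow> 'b::complex_inner"
  assumes T: "bounded_clinear T"
  shows "cinner (T x) y = cinner x (cadjoint T y)"
proof -
  have bl: "bounded_linear T" and sc: "\<And>a x. T (a *\<^sub>C x) = a *\<^sub>C T x"
    using T by (auto simp: bounded_clinear_def)
  have "\<exists>u. \<forall>x. inner (T x) y = inner x u" for y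
    by (rule riesz_real[OF bounded_linear_compose[OF bounded_linear_inner_left bl]])
  then obtain S where S: "\<And>x y. inner (T x) y = inner x (S y)" by metis
  have cS: "\<forall>x y. cinner (T x) y = cinner x (S y)"
    by (simp add: cinner_eq_inner S sc[symmetric])
  have "S' = S" if S': "\<forall>x y. cinner (T x) y = cinner x (S' y)" for S'
  proof
    fix y
    have "cinner x (S' y) = cinner x (S y)" for x using S' cS by metis
    then have "\<forall>x. inner x (S' y) = inner x (S y)" by (simp add: inner_eq_Re_cinner)
    then show "S' y = S y" by (simp only: vector_eq_ldot)
  qed
  with cS have "cadjoint T = S" unfolding cadjoint_def by (intro the_equality) auto
  then show ?thesis using cS by simp
qed

end

theory Submission
  imports Defs
begin

text \<open>
  The operator \<open>T\<close> is in fact normal, which is more than hyponormal.  Let \<open>R\<close> be the union of all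
  subspaces that are invariant under \<open>T\<close> and its adjoint \<open>T*\<close> and on which \<open>T\<close> and \<open>T*\<close> commute,
  and let \<open>L\<close> be its orthogonal complement, which is again invariant under both.  The
  self-commutator \<open>T*T - TT*\<close> is self-adjoint and vanishes on \<open>R\<close>, so its range lies in \<open>L\<close>.
  Hence it is enough to show \<open>L = {0}\<close>, and for this to find a nonzero subspace of \<open>L\<close> among those
  that make up \<open>R\<close>.

  Suppose \<open>L \<noteq> {0}\<close>.  Because \<open>N(T) = N(T*)\<close>, the null space is contained in \<open>R\<close>, so that both
  \<open>T\<close> and \<open>T*\<close> are injective on \<open>L\<close>.  The minimum \<open>m\<close> of the norm of \<open>Tx\<close> over the unit vectors
  of \<open>L\<close> is attained, therefore positive, and so \<open>T\<close> maps \<open>L\<close> onto \<open>L\<close>: its range in \<open>L\<close> is closed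
  since \<open>T\<close> is bounded below, and dense since \<open>T*\<close> is injective there.  Let \<open>P\<close> be the set of the
  \<open>x \<in> L\<close> at which \<open>norm (T x) = m * norm x\<close>.  The quadratic form
  \<open>(norm (T x))\<^sup>2 - m\<^sup>2 * (norm x)\<^sup>2\<close> is nonnegative on \<open>L\<close> and vanishes on \<open>P\<close>; hence
  \<open>T*T x = m\<^sup>2 x\<close> for \<open>x \<in> P\<close> (lemma \<open>cinner_image_min_attaining\<close>), and \<open>P\<close> is a closed subspace.
  Paranormality at \<open>z\<close> shows that \<open>z \<in> P\<close> whenever \<open>z \<in> L\<close> and \<open>Tz \<in> P\<close>, that is,
  \<open>P \<subseteq> T(P)\<close>.  If this inclusion is an equality, then \<open>P\<close> is invariant under \<open>T\<close> and \<open>T*\<close> and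
  there \<open>T\<close> is \<open>m\<close> times a unitary operator, so \<open>P\<close> is the subspace wanted.

  Equality is where the absolute minimum property enters for a second time.  If \<open>P\<close> were a proper
  subspace of \<open>T(P)\<close>, then the spaces \<open>T\<^sup>k(P)\<close>, \<open>k\<close> an integer, would form a strictly increasing
  chain, and picking a unit vector in the difference of any two neighbours would give an
  orthonormal sequence \<open>e n\<close> in \<open>P\<close> and another one \<open>f n\<close> orthogonal to \<open>P\<close>
  (lemma \<open>image_min_attaining_set_subset\<close>).  Such sequences cannot coexist: on the closed span
  of the vectors \<open>e n + f n / (n + 1)\<close> the infimum is \<open>m\<close> but it is not attained
  (lemma \<open>no_orthonormal_pair_of_sequences\<close>).
\<close>

section \<open>Complex inner products and orthogonal complements\<close>

lemma cinner_add_right: "cinner x (y + z) = cinner x y + cinner x z"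
  for x y z :: "'a::complex_inner"
  by (metis cinner_commute cinner_add_left complex_cnj_add)

lemma cinner_scaleC_right: "cinner x (a *\<^sub>C y) = cnj a * cinner x y"
  for x y :: "'a::complex_inner"
  by (metis cinner_commute cinner_scaleC_left complex_cnj_mult)

lemma cinner_scaleR_left: "cinner (r *\<^sub>R x) y = of_real r * cinner x y"
  for x y :: "'a::complex_inner"
  by (metis cinner_scaleC_left scaleC_of_real)

lemma cinner_scaleR_right: "cinner x (r *\<^sub>R y) = of_real r * cinner x y"
  for x y :: "'a::complex_inner"
  by (metis cinner_scaleC_right scaleC_of_real complex_cnj_complex_of_real)

lemma cinner_zero_left [simp]: "cinner 0 y = 0" for y :: "'a::complex_inner"
  using cinner_scaleR_left[of 0 0 y] by simp

lemma cinner_zero_right [simp]: "cinner x 0 = 0" for x :: "'a::complex_inner"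
  using cinner_scaleR_right[of x 0 0] by simp

lemma cinner_diff_left: "cinner (x - y) z = cinner x z - cinner y z"
  for x y z :: "'a::complex_inner"
  using cinner_add_left[of "x - y" y z] by simp

lemma cinner_diff_right: "cinner x (y - z) = cinner x y - cinner x z"
  for x y z :: "'a::complex_inner"
  using cinner_add_right[of x "y - z" z] by simp

lemmas cinner_simps = cinner_add_left cinner_add_right cinner_diff_left cinner_diff_right
  cinner_scaleC_left cinner_scaleC_right cinner_scaleR_left cinner_scaleR_right

lemma cinner_self: "cinner x x = of_real ((norm x)\<^sup>2)" for x :: "'a::complex_inner"
proof -
  have "Im (cinner x x) = 0" using cinner_commute[of x x] by (simp add: complex_eq_iff)
  then show ?thesis
    by (simp add: complex_eq_iff power2_norm_eq_inner inner_eq_Re_cinner)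
qed

lemma cinner_self_eq_zero [simp]: "cinner x x = 0 \<longleftrightarrow> x = 0" for x :: "'a::complex_inner"
  by (simp add: cinner_self)

lemma norm_eq_1_of_cinner: "cinner x x = 1 \<Longrightarrow> norm x = 1" for x :: "'a::complex_inner"
  unfolding cinner_self of_real_eq_1_iff by (simp add: power2_eq_1_iff) (use norm_ge_zero[of x] in linarith)
lemma cinner_zero_commute: "cinner x y = 0 \<longleftrightarrow> cinner y x = 0" for x y :: "'a::complex_inner"
  by (metis cinner_commute complex_cnj_zero)

lemma cinner_eq_zero_iff_inner:
  "cinner x y = 0 \<longleftrightarrow> inner x y = 0 \<and> inner (\<i> *\<^sub>C x) y = 0" for x y :: "'a::complex_inner"
  by (simp add: cinner_eq_inner complex_eq_iff)

lemma norm_scaleC: "norm (a *\<^sub>C x) = cmod a * norm x" for x :: "'a::complex_inner"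
proof -
  have "complex_of_real ((norm (a *\<^sub>C x))\<^sup>2) = a * cnj a * of_real ((norm x)\<^sup>2)"
    by (metis cinner_self cinner_scaleC_left cinner_scaleC_right mult.assoc)
  also have "\<dots> = of_real ((cmod a * norm x)\<^sup>2)"
    by (simp add: complex_mult_cnj cmod_power2 power_mult_distrib)
  finally have "(norm (a *\<^sub>C x))\<^sup>2 = (cmod a * norm x)\<^sup>2" using of_real_eq_iff by blast
  then show ?thesis by simp
qed

lemma complex_subspace_imp_subspace:
  "complex_vector.subspace A \<Longrightarrow> subspace A" for A :: "'a::complex_inner set"
  unfolding complex_vector.subspace_def real_vector.subspace_def by (metis scaleC_of_real)

definition orth_compl :: "'a::complex_inner set \<Rightarrow> 'a set"
  where "orth_compl A = {y. \<forall>x\<in>A. cinner x y = 0}"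

lemma subspace_orth_compl: "complex_vector.subspace (orth_compl A)"
  by (auto simp: complex_vector.subspace_def orth_compl_def cinner_simps)

lemma closed_orth_compl: "closed (orth_compl A)"
proof -
  have "orth_compl A = (\<Inter>x\<in>A. {y. inner x y = 0} \<inter> {y. inner (\<i> *\<^sub>C x) y = 0})"
    by (auto simp: orth_compl_def cinner_eq_zero_iff_inner)
  then show ?thesis
    by (auto intro!: closed_INT closed_Int closed_Collect_eq continuous_intros)
qed

lemma subset_orth_compl_orth_compl: "A \<subseteq> orth_compl (orth_compl A)"
  by (auto simp: orth_compl_def cinner_zero_commute)

section \<open>Projection onto closed subspaces\<close>

text \<open>
  The foot \<open>a\<close> is the point of \<open>A\<close> nearest to \<open>x\<close>.  It exists because the parallelogram law makes
  every minimising sequence a Cauchy sequence, and \<open>x - a\<close> is orthogonal to \<open>A\<close> since moving \<open>a\<close>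
  in a direction of \<open>A\<close> cannot bring it closer to \<open>x\<close>.
\<close>
lemma exists_orthogonal_projection:
  fixes A :: "'a::{real_inner, complete_space} set"
  assumes A: "subspace A" "closed A"
  shows "\<exists>a\<in>A. \<forall>b\<in>A. inner b (x - a) = 0"
proof -
  define d where "d = infdist x A"
  have ne: "A \<noteq> {}" using subspace_0[OF A(1)] by auto
  have d_le: "d \<le> norm (x - a)" if "a \<in> A" for a
    using infdist_le[OF that, of x] by (simp add: d_def dist_norm)
  have d0: "d \<ge> 0" by (simp add: d_def infdist_nonneg)
  have "\<exists>a\<in>A. norm (x - a) < d + 1 / real (Suc n)" for n
  proof -
    have "(INF a\<in>A. dist x a) < d + 1 / real (Suc n)"
      using infdist_notempty[OF ne, of x] by (simp add: d_def)
    moreover have "bdd_below (dist x ` A)" by (rule bdd_belowI2[of _ 0]) simp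
    ultimately show ?thesis
      using cINF_less_iff[OF ne, of "dist x"] by (auto simp: dist_norm)
  qed
  then obtain X where X: "\<And>n. X n \<in> A" "\<And>n. norm (x - X n) < d + 1 / real (Suc n)"
    by metis
  have lim: "(\<lambda>n. norm (x - X n)) \<longlonglongrightarrow> d"
  proof (rule tendsto_sandwich)
    show "(\<lambda>n. d) \<longlonglongrightarrow> d" by simp
    show "(\<lambda>n. d + 1 / real (Suc n)) \<longlonglongrightarrow> d"
      using LIMSEQ_inverse_real_of_nat_add[of d] by (simp add: inverse_eq_divide)
  qed (use X d_le in \<open>auto intro!: always_eventually less_imp_le\<close>)
  have par: "(dist (X i) (X j))\<^sup>2 \<le> 2 * (norm (x - X i))\<^sup>2 + 2 * (norm (x - X j))\<^sup>2 - 4 * d\<^sup>2" for i j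
  proof -
    have "(1/2) *\<^sub>R (X i + X j) \<in> A"
      using X(1) A(1) by (simp add: subspace_add subspace_scale)
    from d_le[OF this] have "2 * d \<le> norm (2 *\<^sub>R (x - (1/2) *\<^sub>R (X i + X j)))" by simp
    also have "2 *\<^sub>R (x - (1/2) *\<^sub>R (X i + X j)) = (x - X i) + (x - X j)"
      by (simp add: algebra_simps scaleR_2)
    finally have "(2 * d)\<^sup>2 \<le> (norm ((x - X i) + (x - X j)))\<^sup>2"
      using d0 by (intro power_mono) auto
    then show ?thesis
      by (simp add: dist_norm power2_norm_eq_inner inner_simps power_mult_distrib inner_commute)
  qed
  have "Cauchy X"
  proof (rule metric_CauchyI)
    fix e :: real assume e: "e > 0"
    have "(\<lambda>n. (norm (x - X n))\<^sup>2) \<longlonglongrightarrow> d\<^sup>2" using lim by (rule tendsto_power)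
    then have "\<forall>\<^sub>F n in sequentially. (norm (x - X n))\<^sup>2 < d\<^sup>2 + e\<^sup>2 / 4"
      using e by (intro order_tendstoD) auto
    then obtain N where N: "\<And>n. n \<ge> N \<Longrightarrow> (norm (x - X n))\<^sup>2 < d\<^sup>2 + e\<^sup>2 / 4"
      by (auto simp: eventually_sequentially)
    have "dist (X i) (X j) < e" if "i \<ge> N" "j \<ge> N" for i j
    proof -
      have "(dist (X i) (X j))\<^sup>2 < e\<^sup>2" using par[of i j] N[OF that(1)] N[OF that(2)] by linarith
      then show ?thesis using e by (simp add: power2_less_imp_less)
    qed
    then show "\<exists>M. \<forall>m\<ge>M. \<forall>n\<ge>M. dist (X m) (X n) < e" by blast
  qed
  then obtain a where a: "X \<longlonglongrightarrow> a" by (auto simp: Cauchy_convergent_iff convergent_def)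
  have aA: "a \<in> A" using closed_sequentially[OF A(2) _ a] X(1) by blast
  have "(\<lambda>n. norm (x - X n)) \<longlonglongrightarrow> norm (x - a)" by (intro tendsto_intros a)
  then have na: "norm (x - a) = d" using lim by (rule LIMSEQ_unique)
  have "inner b (x - a) = 0" if b: "b \<in> A" for b
  proof (rule ccontr)
    assume h: "inner b (x - a) \<noteq> 0"
    then have "b \<noteq> 0" by auto
    then have bb: "inner b b > 0" by simp
    \<comment> \<open>the step that would minimise the distance along the line through \<open>a\<close> in direction \<open>b\<close>\<close>
    define t where "t = inner b (x - a) / inner b b"
    have "a + t *\<^sub>R b \<in> A" using A(1) aA b by (simp add: subspace_add subspace_scale)
    then have "norm (x - a) \<le> norm ((x - a) - t *\<^sub>R b)"
      using d_le[of "a + t *\<^sub>R b"] na by (simp add: diff_diff_eq)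
    then have "(norm (x - a))\<^sup>2 \<le> (norm ((x - a) - t *\<^sub>R b))\<^sup>2" by (intro power_mono) auto
    also have "\<dots> = (norm (x - a))\<^sup>2 - 2 * t * inner b (x - a) + t * t * inner b b"
      unfolding power2_norm_eq_inner
      by (simp add: inner_diff_left inner_diff_right inner_commute algebra_simps)
    finally have "0 \<le> - 2 * t * inner b (x - a) + t * t * inner b b" by simp
    also have "\<dots> = - ((inner b (x - a))\<^sup>2 / inner b b)"
      using bb by (simp add: t_def field_simps power2_eq_square)
    finally have "(inner b (x - a))\<^sup>2 / inner b b \<le> 0" by simp
    moreover have "(inner b (x - a))\<^sup>2 / inner b b > 0" using h bb by simp
    ultimately show False by simp
  qed
  then show ?thesis using aA by blast
qed

text \<open>
  Orthogonality for the real inner product is enough here: since \<open>A\<close> is a complex subspace, a vector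
  that is orthogonal to \<open>b\<close> and to \<open>\<i> *\<^sub>C b\<close> for every \<open>b \<in> A\<close> is orthogonal to \<open>A\<close> for \<open>cinner\<close> too.
\<close>
lemma exists_unit_orth_compl:
  fixes A B :: "'a::chilbert_space set"
  assumes A: "complex_vector.subspace A" "closed A"
    and B: "complex_vector.subspace B" and AB: "A \<subset> B"
  shows "\<exists>u\<in>B. norm u = 1 \<and> u \<in> orth_compl A"
proof -
  obtain x where x: "x \<in> B" "x \<notin> A" using AB by blast
  obtain a where a: "a \<in> A" "\<forall>b\<in>A. inner b (x - a) = 0"
    using exists_orthogonal_projection[OF complex_subspace_imp_subspace[OF A(1)] A(2)] by blast
  have v: "x - a \<in> B" "x - a \<noteq> 0"
    using x a AB complex_vector.subspace_diff[OF B] by auto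
  have vA: "x - a \<in> orth_compl A"
    using a A(1) by (auto simp: orth_compl_def cinner_eq_zero_iff_inner complex_vector.subspace_scale)
  define u where "u = complex_of_real (1 / norm (x - a)) *\<^sub>C (x - a)"
  have "u \<in> B" "u \<in> orth_compl A"
    unfolding u_def using v vA B subspace_orth_compl complex_vector.subspace_scale by blast+
  moreover have "norm u = 1" using v(2) by (simp add: u_def norm_scaleC norm_divide)
  ultimately show ?thesis by blast
qed

section \<open>The vectors at which the minimum is attained\<close>
lemma min_attaining_onE:
  assumes T: "bounded_clinear T" and M: "complex_vector.subspace M"
    and "min_attaining_on M T"
  obtains v where "v \<in> M" "norm v = 1" "\<And>x. x \<in> M \<Longrightarrow> norm (T v) * norm x \<le> norm (T x)"
proof -
  obtain v where v: "v \<in> M" "norm v = 1" "norm (T v) = min_modulus_on M T"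
    using assms(3) unfolding min_attaining_on_def by blast
  have "norm (T v) * norm x \<le> norm (T x)" if "x \<in> M" for x
  proof (cases "x = 0")
    case False
    let ?y = "complex_of_real (1 / norm x) *\<^sub>C x"
    have y: "?y \<in> M" "norm ?y = 1"
      using False M that complex_vector.subspace_scale by (blast, simp add: norm_scaleC norm_divide)
    have "bdd_below {norm (T x) | x. x \<in> M \<and> norm x = 1}" by (rule bdd_belowI[of _ 0]) auto
    then have "norm (T v) \<le> norm (T ?y)"
      unfolding v(3) min_modulus_on_def using y by (intro cInf_lower) auto
    also have "\<dots> = norm (T x) / norm x"
      using T by (simp add: bounded_clinear_def norm_scaleC norm_divide del: scaleC_of_real)
    finally show ?thesis using False by (simp add: field_simps)
  qed simp
  then show thesis using that v by blast
qed

text \<open>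
  A vector \<open>v\<close> of the closed span of the \<open>g n = e n + r n *\<^sub>R f n\<close> satisfies
  \<open>cinner v (f n) = r n * cinner v (e n)\<close>.  Hence, if the minimum \<open>m\<close> were attained at \<open>v\<close>,
  so that \<open>v\<close> is orthogonal to all \<open>f n\<close>, then \<open>v\<close> would be orthogonal to all \<open>e n\<close> as well and
  therefore to its own span.  On the other hand the norm of \<open>T (g n)\<close> tends to \<open>m\<close>, since \<open>r n\<close>
  tends to \<open>0\<close>.
\<close>
lemma no_orthonormal_pair_of_sequences:
  fixes T :: "'h::chilbert_space \<Rightarrow> 'h" and e f :: "nat \<Rightarrow> 'h"
  assumes AM: "absolutely_min_attaining T"
    and L: "complex_vector.subspace L" "closed L"
    and m: "\<And>x. x \<in> L \<Longrightarrow> m * norm x \<le> norm (T x)"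
    and e: "\<And>n. e n \<in> L" "\<And>n. norm (T (e n)) = m"
    and f: "\<And>n. f n \<in> L"
      "\<And>n x. x \<in> L \<Longrightarrow> norm (T x) = m * norm x \<Longrightarrow> cinner x (f n) = 0"
    and on_e: "\<And>i j. cinner (e i) (e j) = (if i = j then 1 else 0)"
    and on_f: "\<And>i j. cinner (f i) (f j) = (if i = j then 1 else 0)"
  shows False
proof -
  have T: "bounded_clinear T" using AM by (simp add: absolutely_min_attaining_def)
  interpret T: bounded_linear T using T by (simp add: bounded_clinear_def)
  have ne: "norm (e n) = 1" for n using on_e[of n n] by (intro norm_eq_1_of_cinner) simp
  have nf: "norm (f n) = 1" for n using on_f[of n n] by (intro norm_eq_1_of_cinner) simp
  have ef: "cinner (e i) (f j) = 0" for i j using f(2)[OF e(1)] e(2) ne by simp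
  then have fe: "cinner (f j) (e i) = 0" for i j by (simp add: cinner_zero_commute)
  define r where "r n = 1 / real (Suc n)" for n
  have r_nz: "r n \<noteq> 0" for n by (simp add: r_def)
  define g where "g n = e n + r n *\<^sub>R f n" for n
  \<comment> \<open>the double complement stands for the closed span; it is a closed complex subspace by construction\<close>
  define M where "M = L \<inter> orth_compl (orth_compl (range g))"
  have gM: "g n \<in> M" for n
  proof -
    have "g n \<in> L" unfolding g_def
      using e f L complex_subspace_imp_subspace subspace_add subspace_scale by blast
    then show ?thesis using subset_orth_compl_orth_compl[of "range g"] by (auto simp: M_def)
  qed
  have g_unit: "1 \<le> norm (g n)" for n
  proof -
    have "complex_of_real ((norm (g n))\<^sup>2) = of_real (1 + (r n)\<^sup>2)"
      unfolding cinner_self[symmetric]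
      by (simp add: g_def cinner_simps on_e on_f ef fe power2_eq_square)
    then have "(norm (g n))\<^sup>2 = 1 + (r n)\<^sup>2" using of_real_eq_iff by blast
    then have "1\<^sup>2 \<le> (norm (g n))\<^sup>2" by simp
    then show ?thesis by (rule power2_le_imp_le) simp
  qed
  have M: "complex_vector.subspace M" "closed M"
    unfolding M_def using L by (auto intro: complex_vector.subspace_inter subspace_orth_compl closed_orth_compl)
  have "M \<noteq> {0}" using gM[of 0] g_unit[of 0] by force
  then have "min_attaining_on M T"
    using AM M unfolding absolutely_min_attaining_def by blast
  then obtain v where v: "v \<in> M" "norm v = 1"
    and v_le: "\<And>x. x \<in> M \<Longrightarrow> norm (T v) * norm x \<le> norm (T x)"
    using min_attaining_onE[OF T M(1)] by metis
  obtain K where K: "\<And>x. norm (T x) \<le> norm x * K" using T.bounded by blast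
  have bound: "norm (T v) \<le> m + r n * K" for n
  proof -
    have "norm (T v) \<le> norm (T v) * norm (g n)" using g_unit[of n] mult_left_mono[of 1 "norm (g n)" "norm (T v)"] by simp
    also have "\<dots> \<le> norm (T (g n))" by (rule v_le[OF gM])
    also have "\<dots> \<le> norm (T (e n)) + norm (r n *\<^sub>R T (f n))"
      unfolding g_def T.add T.scaleR by (rule norm_triangle_ineq)
    also have "\<dots> \<le> m + r n * K"
      using K[of "f n"] nf[of n] e(2)[of n] by (auto simp: r_def intro!: mult_left_mono divide_right_mono)
    finally show ?thesis .
  qed
  have "(\<lambda>n. m + r n * K) \<longlonglongrightarrow> m + 0 * K"
    unfolding r_def by (intro tendsto_intros LIMSEQ_Suc[OF lim_1_over_n])
  then have "norm (T v) \<le> m"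
    using bound by (intro LIMSEQ_le_const) auto
  then have vP: "norm (T v) = m * norm v" and vL: "v \<in> L"
    using m[of v] v by (auto simp: M_def)
  \<comment> \<open>the relation between the coefficients of \<open>v\<close>, as orthogonality to a vector of the complement\<close>
  have "cinner (g k) (f n - r n *\<^sub>R e n) = 0" for k n
    by (simp add: g_def cinner_simps on_e on_f ef fe)
  then have "f n - r n *\<^sub>R e n \<in> orth_compl (range g)" for n
    by (auto simp: orth_compl_def)
  then have "cinner (f n - r n *\<^sub>R e n) v = 0" for n
    using v(1) by (auto simp: M_def orth_compl_def)
  then have "cinner v (f n - r n *\<^sub>R e n) = 0" for n by (simp add: cinner_zero_commute)
  moreover have vf: "cinner v (f n) = 0" for n using f(2)[OF vL vP] .
  ultimately have "cinner v (e n) = 0" for n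
    by (simp add: cinner_simps r_nz)
  then have "cinner v (g n) = 0" for n by (simp add: g_def cinner_simps vf)
  then have "v \<in> orth_compl (range g)" by (auto simp: orth_compl_def cinner_zero_commute)
  then have "cinner v v = 0" using v(1) by (auto simp: M_def orth_compl_def)
  then show False using v(2) by simp
qed

section \<open>Invariance of the minimising subspace\<close>
lemma orthonormal_of_nested:
  fixes u :: "nat \<Rightarrow> 'a::complex_inner"
  assumes "\<And>n. norm (u n) = 1" and lt: "\<And>i j. i < j \<Longrightarrow> cinner (u i) (u j) = 0"
  shows "cinner (u i) (u j) = (if i = j then 1 else 0)"
  using assms(1)[of i] lt[of i j] lt[of j i] cinner_zero_commute[of "u i" "u j"]
  by (cases i j rule: linorder_cases) (auto simp: cinner_self)

lemma complex_subspace_image: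
  assumes T: "bounded_clinear T" and A: "complex_vector.subspace A"
  shows "complex_vector.subspace (T ` A)"
proof -
  have bl: "bounded_linear T" and sc: "\<And>a x. T (a *\<^sub>C x) = a *\<^sub>C T x"
    using T by (auto simp: bounded_clinear_def)
  interpret T: bounded_linear T by (rule bl)
  show ?thesis
    unfolding complex_vector.subspace_def
  proof (intro conjI ballI allI)
    show "0 \<in> T ` A" using complex_vector.subspace_0[OF A] T.zero by force
  next
    fix x y assume "x \<in> T ` A" "y \<in> T ` A"
    then obtain x' y' where "x' \<in> A" "y' \<in> A" "x = T x'" "y = T y'" by blast
    then show "x + y \<in> T ` A" using complex_vector.subspace_add[OF A]
      by (auto intro!: image_eqI[of _ _ "x' + y'"] simp: T.add)
  next
    fix c x assume "x \<in> T ` A"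
    then obtain x' where "x' \<in> A" "x = T x'" by blast
    then show "c *\<^sub>C x \<in> T ` A" using complex_vector.subspace_scale[OF A]
      by (auto intro!: image_eqI[of _ _ "c *\<^sub>C x'"] simp: sc)
  qed
qed

lemma closed_image_of_bounded_below:
  fixes T :: "'h::chilbert_space \<Rightarrow> 'h"
  assumes T: "bounded_clinear T" and A: "complex_vector.subspace A" "closed A"
    and m: "0 < m" "\<And>x. x \<in> A \<Longrightarrow> m * norm x \<le> norm (T x)"
  shows "closed (T ` A)"
proof -
  have "complete (T ` A)"
    using T A m complex_subspace_imp_subspace[OF A(1)]
    by (intro complete_isometric_image[where e = m])
      (auto simp: complete_eq_closed bounded_clinear_def mult.commute)
  then show ?thesis by (rule complete_imp_closed)
qed

text \<open>
  By the assumption \<open>pullback\<close> the inverse of \<open>T\<close> on \<open>L\<close> maps \<open>P\<close> into itself.  In finite dimension or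
  codimension an injective map with this property is onto, and \<open>T\<close> preserves \<open>P\<close>.  Otherwise
  dimensions prove nothing, and the absolute minimum property takes their place: the spaces
  \<open>A n\<close>, images of \<open>P\<close> under the powers of \<open>T\<close>, and \<open>B n\<close>, its preimages, would be strictly monotone
  on both sides of \<open>P\<close>, which yields the two sequences excluded by
  \<open>no_orthonormal_pair_of_sequences\<close>.
\<close>
lemma image_min_attaining_set_subset:
  fixes T :: "'h::chilbert_space \<Rightarrow> 'h"
  assumes AM: "absolutely_min_attaining T"
    and L: "complex_vector.subspace L" "closed L"
    and TL: "T ` L = L"
    and m: "0 < m" "\<And>x. x \<in> L \<Longrightarrow> m * norm x \<le> norm (T x)"
    and P_def: "P = {x \<in> L. norm (T x) = m * norm x}"
    and P: "complex_vector.subspace P"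
    and pullback: "\<And>z. z \<in> L \<Longrightarrow> T z \<in> P \<Longrightarrow> z \<in> P"
  shows "T ` P \<subseteq> P"
proof (rule ccontr)
  have T: "bounded_clinear T" using AM by (simp add: absolutely_min_attaining_def)
  have bl: "bounded_linear T" and sc: "\<And>a x. T (a *\<^sub>C x) = a *\<^sub>C T x"
    using T by (auto simp: bounded_clinear_def)
  interpret T: bounded_linear T by (rule bl)
  note cont = linear_continuous_on[OF bl]
  assume "\<not> T ` P \<subseteq> P"
  then obtain p where p: "p \<in> P" "T p \<notin> P" by blast
  have PL: "P \<subseteq> L" by (auto simp: P_def)
  have "P = L \<inter> {x. norm (T x) = m * norm x}" by (auto simp: P_def)
  then have P_closed: "closed P"
    using L(2) cont by (auto intro!: closed_Int closed_Collect_eq continuous_intros)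
  have inj: "inj_on T L"
  proof (rule inj_onI)
    fix x y assume xy: "x \<in> L" "y \<in> L" "T x = T y"
    have "m * norm (x - y) \<le> norm (T (x - y))"
      using xy L(1) by (intro m(2)) (simp add: complex_vector.subspace_diff)
    then show "x = y" using xy(3) m(1) by (simp add: T.diff mult_le_0_iff)
  qed
  have TnL: "(T ^^ n) ` L = L" for n
  proof (induction n)
    case (Suc n)
    have "(T ^^ Suc n) ` L = T ` (T ^^ n) ` L" by (simp add: image_comp)
    also have "\<dots> = L" unfolding Suc by (rule TL)
    finally show ?case .
  qed simp
  have injn: "inj_on (T ^^ n) L" for n
  proof (induction n)
    case (Suc n)
    have "inj_on (T \<circ> (T ^^ n)) L" using Suc inj TnL[of n] by (intro comp_inj_on) simp_all
    then show ?case by (simp add: comp_def)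
  qed simp
  have P_sub: "P \<subseteq> T ` P"
  proof
    fix x assume x: "x \<in> P"
    then obtain z where "z \<in> L" "x = T z" using TL PL by blast
    then show "x \<in> T ` P" using pullback x by blast
  qed

  define A where "A n = (T ^^ n) ` P" for n
  have A_Suc: "A (Suc n) = T ` A n" for n by (simp add: A_def image_comp)
  have AL: "A n \<subseteq> L" for n using TnL[of n] PL by (auto simp: A_def)
  have A_subsp: "complex_vector.subspace (A n)" for n
    by (induction n) (simp_all add: A_Suc complex_subspace_image T, simp add: A_def P)
  have A_closed: "closed (A n)" for n
  proof (induction n)
    case (Suc n)
    then show ?case
      unfolding A_Suc using AL[of n] m by (intro closed_image_of_bounded_below[OF T A_subsp]) auto
  qed (simp add: A_def P_closed)
  have A_mono1: "A n \<subseteq> A (Suc n)" for n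
    by (induction n) (use P_sub in \<open>auto simp: A_Suc, auto simp: A_def\<close>)
  then have A_mono: "i \<le> j \<Longrightarrow> A i \<subseteq> A j" for i j by (rule lift_Suc_mono_le)
  have A_strict: "A n \<subset> A (Suc n)" for n
  proof -
    have "(T ^^ n) (T p) \<in> A (Suc n)" using p(1) by (auto simp: A_def funpow_swap1)
    moreover have "(T ^^ n) (T p) \<notin> A n"
    proof
      assume "(T ^^ n) (T p) \<in> A n"
      then obtain q where q: "q \<in> P" "(T ^^ n) (T p) = (T ^^ n) q" by (auto simp: A_def)
      then have "T p = q" using inj_onD[OF injn[of n]] p(1) PL TL by blast
      then show False using q p by simp
    qed
    ultimately show ?thesis using A_mono1[of n] by blast
  qed
  obtain f where f: "\<And>n. f n \<in> A (Suc n)" "\<And>n. norm (f n) = 1" "\<And>n. f n \<in> orth_compl (A n)"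
    using exists_unit_orth_compl[OF A_subsp A_closed A_subsp A_strict] by metis

  define B where "B n = {x \<in> L. (T ^^ n) x \<in> P}" for n
  have BL: "B n \<subseteq> L" for n by (auto simp: B_def)
  have B0: "B 0 = P" using PL by (auto simp: B_def)
  have B_Suc: "B (Suc n) = {x \<in> L. T x \<in> B n}" for n using TL by (auto simp: B_def funpow_swap1)
  have B_subsp: "complex_vector.subspace (B n)" for n
  proof (induction n)
    case (Suc n)
    then show ?case using L(1) unfolding B_Suc
      by (simp add: complex_vector.subspace_def T.add sc T.zero)
  qed (simp add: B0 P)
  have B_closed: "closed (B n)" for n
  proof (induction n)
    case (Suc n)
    have "B (Suc n) = L \<inter> T -` B n" unfolding B_Suc by auto
    then show ?case using L(2) Suc cont by (simp add: closed_Int closed_vimage)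
  qed (simp add: B0 P_closed)
  have B_mono1: "B (Suc n) \<subseteq> B n" for n
    using pullback TnL[of n] by (auto simp: B_def)
  then have B_mono: "i \<le> j \<Longrightarrow> B j \<subseteq> B i" for i j by (rule lift_Suc_antimono_le)
  have B_strict: "B (Suc n) \<subset> B n" for n
  proof -
    obtain z where z: "z \<in> L" "(T ^^ n) z = p" using TnL[of n] p(1) PL by (metis imageE subsetD)
    then have "z \<in> B n" "z \<notin> B (Suc n)" using p by (auto simp: B_def)
    then show ?thesis using B_mono1[of n] by blast
  qed
  obtain e where e: "\<And>n. e n \<in> B n" "\<And>n. norm (e n) = 1" "\<And>n. e n \<in> orth_compl (B (Suc n))"
    using exists_unit_orth_compl[OF B_subsp B_closed B_subsp B_strict] by metis

  have eP: "e n \<in> P" for n using e(1)[of n] B_mono[of 0 n] B0 by auto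
  show False
  proof (rule no_orthonormal_pair_of_sequences[OF AM L m(2), of e f])
    show "e n \<in> L" and "norm (T (e n)) = m" for n using eP[of n] e(2)[of n] by (auto simp: P_def)
    show "f n \<in> L" for n using f(1)[of n] AL by blast
    show "cinner x (f n) = 0" if "x \<in> L" "norm (T x) = m * norm x" for n x
      using that f(3)[of n] A_mono[of 0 n] by (auto simp: orth_compl_def P_def A_def)
    show "cinner (f i) (f j) = (if i = j then 1 else 0)" for i j
    proof (rule orthonormal_of_nested[OF f(2)])
      show "cinner (f i) (f j) = 0" if "i < j" for i j
        using f(1)[of i] f(3)[of j] A_mono[of "Suc i" j] that by (auto simp: orth_compl_def)
    qed
    show "cinner (e i) (e j) = (if i = j then 1 else 0)" for i j
    proof (rule orthonormal_of_nested[OF e(2)])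
      show "cinner (e i) (e j) = 0" if "i < j" for i j
        using e(1)[of j] e(3)[of i] B_mono[of "Suc i" j] that
        by (auto simp: orth_compl_def cinner_zero_commute[of "e i"])
    qed
  qed
qed

text \<open>
  A nonnegative quadratic form that vanishes at \<open>x\<close> has \<open>x\<close> in the radical of its bilinear form: along
  the line \<open>y + t *\<^sub>R x\<close> it is affine in \<open>t\<close> with slope \<open>2 * b\<close>, so \<open>b = 0\<close>.  Applied to \<open>x\<close> and
  \<open>\<i> *\<^sub>C x\<close>, this says that \<open>m\<^sup>2\<close> is an eigenvalue of \<open>T*T\<close>, in the weak form.
\<close>
lemma cinner_image_min_attaining:
  fixes T :: "'h::complex_inner \<Rightarrow> 'h"
  assumes T: "bounded_clinear T" and L: "complex_vector.subspace L"
    and m: "\<And>x. x \<in> L \<Longrightarrow> m * norm x \<le> norm (T x)" "0 \<le> m"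
    and x: "x \<in> L" "norm (T x) = m * norm x" and y: "y \<in> L"
  shows "cinner (T x) (T y) = of_real (m\<^sup>2) * cinner x y"
proof -
  have bl: "bounded_linear T" and sc: "\<And>a x. T (a *\<^sub>C x) = a *\<^sub>C T x"
    using T by (auto simp: bounded_clinear_def)
  interpret T: bounded_linear T by (rule bl)
  have re: "inner (T x) (T y) = m\<^sup>2 * inner x y" if x: "x \<in> L" "norm (T x) = m * norm x" for x
  proof (rule ccontr)
    assume ne: "inner (T x) (T y) \<noteq> m\<^sup>2 * inner x y"
    define b where "b = inner (T x) (T y) - m\<^sup>2 * inner x y"
    define q where "q = (norm (T y))\<^sup>2 - m\<^sup>2 * (norm y)\<^sup>2"
    have b: "b \<noteq> 0" using ne by (simp add: b_def)
    have pos: "0 \<le> q + 2 * t * b" for t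
    proof -
      have "y + t *\<^sub>R x \<in> L"
        using x(1) y complex_subspace_imp_subspace[OF L] by (simp add: subspace_add subspace_scale)
      then have "(m * norm (y + t *\<^sub>R x))\<^sup>2 \<le> (norm (T (y + t *\<^sub>R x)))\<^sup>2"
        using m by (intro power_mono) auto
      then have "0 \<le> q + 2 * t * b + t\<^sup>2 * ((norm (T x))\<^sup>2 - m\<^sup>2 * (norm x)\<^sup>2)"
        unfolding q_def b_def power_mult_distrib power2_norm_eq_inner
        by (simp add: T.add T.scaleR inner_simps inner_commute algebra_simps power2_eq_square)
      then show ?thesis using x(2) by (simp add: power_mult_distrib)
    qed
    have "q + 2 * (- (q + 1) / (2 * b)) * b = -1" using b by (simp add: field_simps)
    then show False using pos[of "- (q + 1) / (2 * b)"] by simp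
  qed
  have ix: "\<i> *\<^sub>C x \<in> L" "norm (T (\<i> *\<^sub>C x)) = m * norm (\<i> *\<^sub>C x)"
    using x L by (simp_all add: complex_vector.subspace_scale sc norm_scaleC)
  show ?thesis
    using re[OF x] re[OF ix] by (simp add: cinner_eq_inner sc complex_eq_iff)
qed

section \<open>Paranormal absolutely minimum attaining operators\<close>
lemma cinner_cadjoint_left:
  fixes T :: "'a::chilbert_space \<Rightarrow> 'b::complex_inner"
  assumes "bounded_clinear T"
  shows "cinner (cadjoint T x) y = cinner x (T y)"
  using cinner_cadjoint_right[OF assms, of y x] by (metis cinner_commute)

theorem theorem4p5:
  fixes T :: "'h::chilbert_space \<Rightarrow> 'h"
  assumes "bounded_clinear T"
    and "null_space T = null_space (cadjoint T)"
    and "absolutely_min_attaining T"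
    and "paranormal T"
  shows "hyponormal T"
proof -
  note T = assms(1) and ker = assms(2) and AM = assms(3) and para = assms(4)
  have bl: "bounded_linear T" and sc: "\<And>a x. T (a *\<^sub>C x) = a *\<^sub>C T x"
    using T by (auto simp: bounded_clinear_def)
  interpret T: bounded_linear T by (rule bl)
  let ?S = "cadjoint T"
  note adj = cinner_cadjoint_right[OF T] cinner_cadjoint_left[OF T]
  \<comment> \<open>\<open>R\<close> is a union and not a span: taking the orthogonal complement makes no difference\<close>
  define R where "R = {x. \<exists>V. complex_vector.subspace V \<and> x \<in> V \<and> T ` V \<subseteq> V \<and> ?S ` V \<subseteq> V
    \<and> (\<forall>v\<in>V. ?S (T v) = T (?S v))}"
  have TR: "T x \<in> R" and SR: "?S x \<in> R" and normal_R: "?S (T x) = T (?S x)" if "x \<in> R" for x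
    using that unfolding R_def by blast+
  have null_R: "null_space T \<subseteq> R"
  proof -
    have "complex_vector.subspace (null_space T)"
      by (simp add: complex_vector.subspace_def null_space_def T.add T.zero sc)
    moreover have "T x = 0" "?S x = 0" if "x \<in> null_space T" for x
      using that ker by (auto simp: null_space_def)
    moreover have "0 \<in> null_space T" by (simp add: null_space_def T.zero)
    ultimately show ?thesis unfolding R_def by (auto intro!: exI[of _ "null_space T"])
  qed
  define L where "L = orth_compl R"
  have L: "complex_vector.subspace L" "closed L"
    by (auto simp: L_def subspace_orth_compl closed_orth_compl)
  have TL: "T x \<in> L" and SL: "?S x \<in> L" if "x \<in> L" for x
    using that TR SR by (auto simp: L_def orth_compl_def adj[symmetric])
  have LR: "x = 0" if "x \<in> L" "x \<in> R" for x
    using that by (auto simp: L_def orth_compl_def)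
  have "L = {0}"
  proof (rule ccontr)
    assume "L \<noteq> {0}"
    then have "min_attaining_on L T"
      using AM L unfolding absolutely_min_attaining_def by blast
    then obtain v where v: "v \<in> L" "norm v = 1"
      and v_le: "\<And>x. x \<in> L \<Longrightarrow> norm (T v) * norm x \<le> norm (T x)"
      using min_attaining_onE[OF T L(1)] by metis
    define m where "m = norm (T v)"
    have m: "m * norm x \<le> norm (T x)" if "x \<in> L" for x
      using v_le[OF that] by (simp add: m_def)
    have m0: "0 < m"
      using LR[OF v(1)] null_R v(2) by (auto simp: m_def null_space_def)
    have TL_eq: "T ` L = L"
    proof (rule ccontr)
      assume "T ` L \<noteq> L"
      then have "T ` L \<subset> L" using TL by blast
      then obtain u where u: "u \<in> L" "norm u = 1" "u \<in> orth_compl (T ` L)"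
        using exists_unit_orth_compl[OF complex_subspace_image[OF T L(1)]
            closed_image_of_bounded_below[OF T L m0 m] L(1)] by blast
      have "cinner (?S u) (?S u) = 0"
        using u(3) SL[OF u(1)] by (auto simp: orth_compl_def adj(1)[symmetric])
      then have "u \<in> null_space T" unfolding ker by (simp add: null_space_def)
      then show False using LR u null_R by force
    qed
    define P where "P = {x \<in> L. norm (T x) = m * norm x}"
    have ST: "?S (T x) = of_real (m\<^sup>2) *\<^sub>C x" if "x \<in> P" for x
    proof -
      let ?d = "?S (T x) - of_real (m\<^sup>2) *\<^sub>C x"
      have x: "x \<in> L" "norm (T x) = m * norm x" using that by (auto simp: P_def)
      have d: "?d \<in> L"
        using x L(1) TL SL by (simp add: complex_vector.subspace_diff complex_vector.subspace_scale)
      have "cinner ?d ?d = cinner (T x) (T ?d) - of_real (m\<^sup>2) * cinner x ?d"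
        unfolding cinner_diff_left cinner_scaleC_left adj ..
      also have "\<dots> = 0"
        using cinner_image_min_attaining[OF T L(1) m _ x d] m0 by simp
      finally show ?thesis by simp
    qed
    have P: "complex_vector.subspace P"
      unfolding complex_vector.subspace_def
    proof (intro conjI ballI allI)
      show "0 \<in> P" using L(1) by (simp add: P_def complex_vector.subspace_0 T.zero)
      show "c *\<^sub>C x \<in> P" if "x \<in> P" for c x
        using that L(1) by (simp add: P_def complex_vector.subspace_scale sc norm_scaleC)
      show "x + y \<in> P" if xy: "x \<in> P" "y \<in> P" for x y
      proof -
        have xyL: "x + y \<in> L" using xy L(1) by (simp add: P_def complex_vector.subspace_add)
        have "complex_of_real ((norm (T (x + y)))\<^sup>2) = of_real (m\<^sup>2) * cinner (x + y) (x + y)"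
        proof -
          have "cinner (T z) (T (x + y)) = of_real (m\<^sup>2) * cinner z (x + y)" if "z \<in> P" for z
            using that by (intro cinner_image_min_attaining[OF T L(1) m _ _ _ xyL])
              (use m0 in \<open>auto simp: P_def\<close>)
          from this[OF xy(1)] this[OF xy(2)]
          show ?thesis unfolding cinner_self[symmetric]
            by (metis T.add cinner_add_left distrib_left)
        qed
        then have "(norm (T (x + y)))\<^sup>2 = (m * norm (x + y))\<^sup>2"
          unfolding cinner_self power_mult_distrib by (metis of_real_eq_iff of_real_mult)
        then show ?thesis using m0 xyL by (simp add: P_def)
      qed
    qed
    have pullback: "z \<in> P" if z: "z \<in> L" "T z \<in> P" for z
    proof -
      have "(norm (T z))\<^sup>2 \<le> (m * norm (T z)) * norm z"
        using para[unfolded paranormal_def, rule_format, of z] z(2) by (simp add: P_def)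
      then have "norm (T z) * norm (T z) \<le> norm (T z) * (m * norm z)"
        by (simp add: power2_eq_square algebra_simps)
      then have "norm (T z) \<le> m * norm z"
        using m0 by (cases "T z = 0") auto
      then show ?thesis using m[OF z(1)] z(1) by (simp add: P_def)
    qed
    \<comment> \<open>hence \<open>T\<close> maps \<open>P\<close> onto \<open>P\<close>, and \<open>T*\<close> acts on \<open>P\<close> as \<open>m\<^sup>2\<close> times the inverse of \<open>T\<close>\<close>
    have TP: "T ` P \<subseteq> P"
      by (rule image_min_attaining_set_subset[OF AM L TL_eq m0 m P_def P pullback])
    have P_T: "\<exists>z\<in>P. p = T z" if "p \<in> P" for p
    proof -
      have "p \<in> T ` L" using TL_eq that by (simp add: P_def)
      then obtain z where "z \<in> L" "p = T z" by blast
      then show ?thesis using pullback that by blast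
    qed
    have "?S p \<in> P \<and> ?S (T p) = T (?S p)" if p: "p \<in> P" for p
    proof -
      obtain z where z: "z \<in> P" "p = T z" using P_T[OF p] by blast
      then show ?thesis
        using ST[OF z(1)] ST[OF p] P by (simp add: complex_vector.subspace_scale sc)
    qed
    then have "P \<subseteq> R" using P TP unfolding R_def by blast
    moreover have "v \<in> P" using v by (simp add: P_def m_def)
    ultimately show False using LR[OF v(1)] v(2) by auto
  qed
  moreover have "?S (T x) - T (?S x) \<in> L" for x
  proof -
    have "cinner y (?S (T x) - T (?S x)) = cinner (?S (T y) - T (?S y)) x" for y
      by (simp add: cinner_simps adj)
    then show ?thesis by (simp add: L_def orth_compl_def normal_R)
  qed
  ultimately have "?S (T x) - T (?S x) = 0" for x by blast
  then show ?thesis by (simp add: hyponormal_def op_le_def positive_op_def)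
qed

end
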